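(* Let $n\ge 1$ and let $\Phi=\{\phi_m\}_{m=1}^M\subseteq\{e_i\}_{i=1}^n\cup\{e_i-e_j\}_{1\le i<j\le n}$ be any ensemble. Then the complex-valued intensity map $\mathcal{B}=\mathcal{B}_\Phi:\mathbb{C}^n/\{\pm1\}\to\mathbb{C}^M$, $(\mathcal{B}(x))_m=\langle x,\phi_m\rangle^2$, is injective if and only if the framework $(G_\Phi,p)$ is globally rigid for every configuration $p:V\to\mathbb{C}$, where $G_\Phi=(V,E_\Phi)$ is the graph on $V=\{0,1,\dots,n\}$ defined by $\Phi$.
   Context: Notation: $e_i$ is the $i$-th standard basis vector of $\mathbb{C}^n$, and $\langle x,\phi\rangle=\phi^Hx$, so $\langle x,e_i\rangle^2=x_i^2$ and $\langle x,e_i-e_j\rangle^2=(x_i-x_j)^2$. $\mathbb{C}^n/\{\pm1\}$ is the quotient of $\mathbb{C}^n$ identifying $x$ with $-x$. Graph: $G_\Phi=(V,E_\Phi)$ has vertex set $V=\{0,1,\dots,n\}$. Its edges are the pairs $(i,0)$ with $e_i\in\Phi$ and the pairs $(i,j)$, $1\le i<j\le n$, with $e_i-e_j\in\Phi$. Complex rigidity: for $w,z\in\mathbb{C}$ let $c(w,z)=(w-z)^2$ (a complex number in general). A configuration is a map $p:V\to\mathbb{C}$, and the pair $(G,p)$ is a framework. Frameworks $(G,p)$ and $(G,q)$ are equivalent if $c(p(i),p(j))=c(q(i),q(j))$ for all edges $(i,j)$ of $G$. Configurations $p$ and $q$ are congruent if $c(p(i),p(j))=c(q(i),q(j))$ for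 all $i,j\in V$. A framework $(G,p)$ is globally rigid if for every framework $(G,q)$ equivalent to it, $p$ and $q$ are congruent. *)

theory Defs
  imports "Jordan_Normal_Form.Matrix" "HOL-Library.FuncSet"
begin

section \<open>The intensity map on $\mathbb{C}^n/\{\pm 1\}$\<close>

text \<open>The standard basis vectors are numbered \<open>1, \<dots>, n\<close>, so that the number \<open>0\<close> is free for the
  extra vertex of the graph; coordinates of the type of vectors are numbered from \<open>0\<close>.\<close>

definition std_basis :: "nat \<Rightarrow> nat \<Rightarrow> complex vec" where
  "std_basis n i = unit_vec n (i - 1)"

definition basis_and_differences :: "nat \<Rightarrow> complex vec set" where
  "basis_and_differences n =
     {std_basis n i | i. 1 \<le> i \<and> i \<le> n} \<union>
     {std_basis n i - std_basis n j | i j. 1 \<le> i \<and> i < j \<and> j \<le> n}"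

definition pm_rel :: "nat \<Rightarrow> (complex vec \<times> complex vec) set" where
  "pm_rel n = {(x, y). x \<in> carrier_vec n \<and> y \<in> carrier_vec n \<and> (y = x \<or> y = - x)}"

definition quot_pm :: "nat \<Rightarrow> complex vec set set" where
  "quot_pm n = carrier_vec n // pm_rel n"

text \<open>An ensemble \<open>\<phi>\<^sub>1, \<dots>, \<phi>\<^sub>M\<close> is a list of length \<open>M\<close>; repetitions are allowed.
  The product \<open>x \<bullet>c \<phi>\<close> is conjugate-linear in \<open>\<phi>\<close>.\<close>

definition intensity :: "complex vec list \<Rightarrow> complex vec \<Rightarrow> complex vec" where
  "intensity \<Phi> x = vec (length \<Phi>) (\<lambda>m. (x \<bullet>c (\<Phi> ! m))\<^sup>2)"

text \<open>The map induced on classes; \<open>intensity_quot_class\<close> below shows that it is well defined.\<close>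

definition intensity_quot :: "complex vec list \<Rightarrow> complex vec set \<Rightarrow> complex vec" where
  "intensity_quot \<Phi> X = the_elem (intensity \<Phi> ` X)"

lemma equiv_pm_rel: "equiv (carrier_vec n) (pm_rel n)"
  by (rule equivI) (auto simp: pm_rel_def refl_on_def sym_def trans_def)

lemma intensity_uminus:
  assumes "set \<Phi> \<subseteq> carrier_vec n" and "x \<in> carrier_vec n"
  shows "intensity \<Phi> (- x) = intensity \<Phi> x"
proof -
  have "(- x) \<bullet>c (\<Phi> ! m) = - (x \<bullet>c (\<Phi> ! m))" if "m < length \<Phi>" for m
  proof -
    have "\<Phi> ! m \<in> carrier_vec n"
      using assms(1) that by (meson nth_mem subsetD)
    then show ?thesis using assms(2) by simp
  qed
  then show ?thesis
    by (auto simp: intensity_def)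
qed

lemma basis_and_differences_carrier: "basis_and_differences n \<subseteq> carrier_vec n"
  by (auto simp: basis_and_differences_def std_basis_def)

lemma intensity_quot_class:
  assumes "set \<Phi> \<subseteq> carrier_vec n" and "x \<in> carrier_vec n"
  shows "intensity_quot \<Phi> (pm_rel n `` {x}) = intensity \<Phi> x"
proof -
  have "pm_rel n `` {x} = {x, - x}"
    using assms(2) by (auto simp: pm_rel_def)
  then show ?thesis
    using intensity_uminus[OF assms] by (simp add: intensity_quot_def)
qed


section \<open>Complex frameworks and global rigidity\<close>

text \<open>An undirected graph is a pair of its vertex set and its set of unordered edges.\<close>

type_synonym 'v graph = "'v set \<times> 'v set set"

definition c_sq :: "complex \<Rightarrow> complex \<Rightarrow> complex" where
  "c_sq w z = (w - z)\<^sup>2"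

definition configurations :: "'v graph \<Rightarrow> ('v \<Rightarrow> complex) set" where
  "configurations G = fst G \<rightarrow>\<^sub>E UNIV"

definition equivalent_frameworks :: "'v graph \<Rightarrow> ('v \<Rightarrow> complex) \<Rightarrow> ('v \<Rightarrow> complex) \<Rightarrow> bool" where
  "equivalent_frameworks G p q \<longleftrightarrow>
     (\<forall>i\<in>fst G. \<forall>j\<in>fst G. {i, j} \<in> snd G \<longrightarrow> c_sq (p i) (p j) = c_sq (q i) (q j))"

definition congruent_configurations :: "'v graph \<Rightarrow> ('v \<Rightarrow> complex) \<Rightarrow> ('v \<Rightarrow> complex) \<Rightarrow> bool" where
  "congruent_configurations G p q \<longleftrightarrow>
     (\<forall>i\<in>fst G. \<forall>j\<in>fst G. c_sq (p i) (p j) = c_sq (q i) (q j))"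

definition globally_rigid :: "'v graph \<Rightarrow> ('v \<Rightarrow> complex) \<Rightarrow> bool" where
  "globally_rigid G p \<longleftrightarrow>
     (\<forall>q\<in>configurations G. equivalent_frameworks G p q \<longrightarrow> congruent_configurations G p q)"

definition graph_of :: "nat \<Rightarrow> complex vec list \<Rightarrow> nat graph" where
  "graph_of n \<Phi> =
     ({0..n},
      {{i, 0} | i. 1 \<le> i \<and> i \<le> n \<and> std_basis n i \<in> set \<Phi>} \<union>
      {{i, j} | i j. 1 \<le> i \<and> i < j \<and> j \<le> n \<and> std_basis n i - std_basis n j \<in> set \<Phi>})"

end

theory Submission
  imports Defs
begin

text \<open>Translating a configuration so that the extra vertex \<open>0\<close> sits at the origin turns it into a
  vector of \<open>\<complex>\<^sup>n\<close>, and every vector arises in this way (\<open>anchored_vec_surj\<close>). Under this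
  dictionary both sides of the equivalence express the same property. The measurement by \<open>e\<^sub>i\<close>
  is the squared difference along the edge \<open>(i, 0)\<close>, and the one by \<open>e\<^sub>i - e\<^sub>j\<close> is that along
  \<open>(i, j)\<close>; hence equal intensities mean equivalent frameworks
  (\<open>intensity_eq_iff_equivalent\<close>).

  It remains to see that congruence means equality up to a global sign
  (\<open>congruent_iff_anchored_vec_eq_up_to_sign\<close>). For anchored configurations, congruence says that
  all \<open>x\<^sub>i\<^sup>2\<close> and all \<open>(x\<^sub>i - x\<^sub>j)\<^sup>2\<close> agree with the corresponding \<open>y\<^sub>i\<^sup>2\<close> and
  \<open>(y\<^sub>i - y\<^sub>j)\<^sup>2\<close>. By polarization all products \<open>x\<^sub>i x\<^sub>j\<close> and \<open>y\<^sub>i y\<^sub>j\<close> agree, that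
  is, the rank-one matrices \<open>x x\<^sup>T\<close> and \<open>y y\<^sup>T\<close> coincide, which determines the vector up to
  sign.\<close>

definition anchored_vec :: "nat \<Rightarrow> (nat \<Rightarrow> complex) \<Rightarrow> complex vec" where
  "anchored_vec n p = vec n (\<lambda>k. p (Suc k) - p 0)"

lemma anchored_vec_carrier [simp]: "anchored_vec n p \<in> carrier_vec n"
  by (simp add: anchored_vec_def)

lemma anchored_vec_surj:
  assumes "x \<in> carrier_vec n"
  shows "\<exists>p\<in>configurations (graph_of n \<Phi>). anchored_vec n p = x"
proof
  let ?p = "\<lambda>i\<in>{0..n}. if i = 0 then 0 else x $ (i - 1)"
  show "?p \<in> configurations (graph_of n \<Phi>)"
    by (auto simp: configurations_def graph_of_def)
  show "anchored_vec n ?p = x"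
    using assms by (auto simp: anchored_vec_def)
qed

lemma inner_std_basis:
  assumes "1 \<le> i" "i \<le> n"
  shows "anchored_vec n p \<bullet>c std_basis n i = p i - p 0"
proof -
  have "conjugate (std_basis n i) = std_basis n i"
    by (rule eq_vecI) (auto simp: std_basis_def unit_vec_def)
  then show ?thesis
    using assms by (simp add: std_basis_def anchored_vec_def)
qed

lemma inner_std_basis_diff:
  assumes "1 \<le> i" "i \<le> n" "1 \<le> j" "j \<le> n"
  shows "anchored_vec n p \<bullet>c (std_basis n i - std_basis n j) = p i - p j"
proof -
  have "conjugate (std_basis n i - std_basis n j) = std_basis n i - std_basis n j"
    by (rule eq_vecI) (auto simp: std_basis_def unit_vec_def)
  then show ?thesis
    using assms
    by (simp add: std_basis_def anchored_vec_def scalar_prod_minus_distrib[where n = n])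
qed

lemma intensity_eq_iff:
  "intensity \<Phi> x = intensity \<Phi> y \<longleftrightarrow> (\<forall>\<phi>\<in>set \<Phi>. (x \<bullet>c \<phi>)\<^sup>2 = (y \<bullet>c \<phi>)\<^sup>2)"
  by (simp add: intensity_def vec_eq_iff all_set_conv_all_nth)

lemma c_sq_commute: "c_sq w z = c_sq z w"
  by (simp add: c_sq_def power2_commute)

text \<open>An unordered edge determines its endpoints only up to a swap; since squared differences are
  symmetric, testing the orientation in which the ensemble lists the edge is enough.\<close>

lemma equivalent_frameworks_graph_of_iff:
  "equivalent_frameworks (graph_of n \<Phi>) p q \<longleftrightarrow>
     (\<forall>i. 1 \<le> i \<and> i \<le> n \<and> std_basis n i \<in> set \<Phi> \<longrightarrow> c_sq (p i) (p 0) = c_sq (q i) (q 0)) \<and>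
     (\<forall>i j. 1 \<le> i \<and> i < j \<and> j \<le> n \<and> std_basis n i - std_basis n j \<in> set \<Phi> \<longrightarrow>
        c_sq (p i) (p j) = c_sq (q i) (q j))"
    (is "?E \<longleftrightarrow> ?R")
proof
  assume E: ?E
  have edge: "c_sq (p i) (p j) = c_sq (q i) (q j)"
    if "i \<le> n" "j \<le> n" "{i, j} \<in> snd (graph_of n \<Phi>)" for i j
  proof -
    have "i \<in> fst (graph_of n \<Phi>)" "j \<in> fst (graph_of n \<Phi>)"
      using that by (simp_all add: graph_of_def)
    then show ?thesis
      using E that(3) unfolding equivalent_frameworks_def by blast
  qed
  show ?R
  proof (intro conjI allI impI)
    fix i assume i: "1 \<le> i \<and> i \<le> n \<and> std_basis n i \<in> set \<Phi>"
    then have "{i, 0} \<in> snd (graph_of n \<Phi>)"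
      unfolding graph_of_def snd_conv by blast
    with i show "c_sq (p i) (p 0) = c_sq (q i) (q 0)"
      by (intro edge) simp_all
  next
    fix i j assume ij: "1 \<le> i \<and> i < j \<and> j \<le> n \<and> std_basis n i - std_basis n j \<in> set \<Phi>"
    then have "{i, j} \<in> snd (graph_of n \<Phi>)"
      unfolding graph_of_def snd_conv by blast
    with ij show "c_sq (p i) (p j) = c_sq (q i) (q j)"
      by (intro edge) simp_all
  qed
next
  assume R: ?R
  have "c_sq (p i) (p j) = c_sq (q i) (q j)" if "{i, j} \<in> snd (graph_of n \<Phi>)" for i j
  proof -
    have "\<exists>a b. {i, j} = {a, b} \<and> c_sq (p a) (p b) = c_sq (q a) (q b)"
    proof -
      from that consider
          a where "1 \<le> a \<and> a \<le> n \<and> std_basis n a \<in> set \<Phi>" "{i, j} = {a, 0}"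
        | a b where "1 \<le> a \<and> a < b \<and> b \<le> n \<and> std_basis n a - std_basis n b \<in> set \<Phi>"
            "{i, j} = {a, b}"
        unfolding graph_of_def snd_conv by blast
      then show ?thesis
      proof cases
        case (1 a)
        with R have "c_sq (p a) (p 0) = c_sq (q a) (q 0)" by blast
        with 1(2) show ?thesis by blast
      next
        case (2 a b)
        with R have "c_sq (p a) (p b) = c_sq (q a) (q b)" by blast
        with 2(2) show ?thesis by blast
      qed
    qed
    then obtain a b where ab: "{i, j} = {a, b}" "c_sq (p a) (p b) = c_sq (q a) (q b)"
      by blast
    from ab(1) consider "i = a" "j = b" | "i = b" "j = a"
      by (auto simp: doubleton_eq_iff)
    then show ?thesis
      using ab(2) by cases (simp_all add: c_sq_commute)
  qed
  then show ?E
    by (simp add: equivalent_frameworks_def)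
qed

text \<open>Vertex \<open>0\<close> plays the part of a zeroth basis vector \<open>e\<^sub>0 = 0\<close>: each member of the ensemble
  measures the squared difference along the edge that it contributes to the graph.\<close>

lemma intensity_eq_iff_equivalent:
  assumes "set \<Phi> \<subseteq> basis_and_differences n"
  shows "intensity \<Phi> (anchored_vec n p) = intensity \<Phi> (anchored_vec n q) \<longleftrightarrow>
    equivalent_frameworks (graph_of n \<Phi>) p q" (is "?I \<longleftrightarrow> ?E")
proof
  assume I: ?I
  then have sq: "(anchored_vec n p \<bullet>c \<phi>)\<^sup>2 = (anchored_vec n q \<bullet>c \<phi>)\<^sup>2" if "\<phi> \<in> set \<Phi>" for \<phi>
    using that by (simp add: intensity_eq_iff)
  show ?E
    unfolding equivalent_frameworks_graph_of_iff
  proof (intro conjI allI impI)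
    fix i assume "1 \<le> i \<and> i \<le> n \<and> std_basis n i \<in> set \<Phi>"
    then show "c_sq (p i) (p 0) = c_sq (q i) (q 0)"
      using sq[of "std_basis n i"] by (simp add: inner_std_basis c_sq_def)
  next
    fix i j assume "1 \<le> i \<and> i < j \<and> j \<le> n \<and> std_basis n i - std_basis n j \<in> set \<Phi>"
    then show "c_sq (p i) (p j) = c_sq (q i) (q j)"
      using sq[of "std_basis n i - std_basis n j"] by (simp add: inner_std_basis_diff c_sq_def)
  qed
next
  assume E: ?E
  show ?I
    unfolding intensity_eq_iff
  proof
    fix \<phi> assume \<phi>: "\<phi> \<in> set \<Phi>"
    with assms consider
        i where "1 \<le> i" "i \<le> n" "\<phi> = std_basis n i"
      | i j where "1 \<le> i" "i < j" "j \<le> n" "\<phi> = std_basis n i - std_basis n j"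
      unfolding basis_and_differences_def by blast
    then show "(anchored_vec n p \<bullet>c \<phi>)\<^sup>2 = (anchored_vec n q \<bullet>c \<phi>)\<^sup>2"
    proof cases
      case 1
      then show ?thesis
        using E \<phi> by (simp add: equivalent_frameworks_graph_of_iff inner_std_basis c_sq_def)
    next
      case 2
      then show ?thesis
        using E \<phi> by (simp add: equivalent_frameworks_graph_of_iff inner_std_basis_diff c_sq_def)
    qed
  qed
qed

text \<open>One nonzero coordinate \<open>u k\<close> fixes the sign, because \<open>v k = \<plusminus> u k\<close>; the products with
  \<open>u k\<close> then propagate this sign to all the other coordinates.\<close>

lemma eq_up_to_sign_of_products_eq:
  fixes u v :: "'i \<Rightarrow> 'a :: idom"
  assumes prod: "\<And>i j. i \<in> I \<Longrightarrow> j \<in> I \<Longrightarrow> u i * u j = v i * v j"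
  shows "(\<forall>i\<in>I. v i = u i) \<or> (\<forall>i\<in>I. v i = - u i)"
proof (cases "\<forall>k\<in>I. u k = 0")
  case True
  then have "v i = u i" if "i \<in> I" for i
    using prod[OF that that] that by simp
  then show ?thesis by blast
next
  case False
  then obtain k where k: "k \<in> I" "u k \<noteq> 0"
    by blast
  have "(v k)\<^sup>2 = (u k)\<^sup>2"
    using prod[OF k(1) k(1)] by (simp add: power2_eq_square)
  then consider "v k = u k" | "v k = - u k"
    by (auto simp: power2_eq_iff)
  then show ?thesis
  proof cases
    case 1
    have "v i = u i" if "i \<in> I" for i
      using prod[OF k(1) that] k(2) 1 by simp
    then show ?thesis by blast
  next
    case 2
    have "v i = - u i" if "i \<in> I" for i
    proof -
      have "u k * v i = u k * (- u i)"
        using prod[OF k(1) that] 2 by simp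
      then show ?thesis
        using k(2) by (simp only: mult_cancel_left) simp
    qed
    then show ?thesis by blast
  qed
qed

lemma anchored_vec_eq_iff:
  "anchored_vec n q = anchored_vec n p \<longleftrightarrow> (\<forall>i\<in>{0..n}. q i - q 0 = p i - p 0)"
  "anchored_vec n q = - anchored_vec n p \<longleftrightarrow> (\<forall>i\<in>{0..n}. q i - q 0 = - (p i - p 0))"
proof -
  \<comment> \<open>The coordinate of vertex \<open>0\<close> vanishes after anchoring, so adjoining it imposes no condition.\<close>
  have split: "(\<forall>i\<in>{0..n}. P i) \<longleftrightarrow> P 0 \<and> (\<forall>k<n. P (Suc k))" for P
    using All_less_Suc2[of n P] by (simp add: less_Suc_eq_le Ball_def)
  show "anchored_vec n q = anchored_vec n p \<longleftrightarrow> (\<forall>i\<in>{0..n}. q i - q 0 = p i - p 0)"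
    unfolding split by (simp add: anchored_vec_def vec_eq_iff)
  show "anchored_vec n q = - anchored_vec n p \<longleftrightarrow> (\<forall>i\<in>{0..n}. q i - q 0 = - (p i - p 0))"
    unfolding split by (simp add: anchored_vec_def vec_eq_iff)
qed

text \<open>The squared differences of all pairs of vertices, vertex \<open>0\<close> included, carry the same
  information as the pairwise products of the anchored coordinates, by the polarization identity
  \<open>2 u v = u\<^sup>2 + v\<^sup>2 - (u - v)\<^sup>2\<close>.\<close>

lemma congruent_iff_anchored_vec_eq_up_to_sign:
  "congruent_configurations (graph_of n \<Phi>) p q \<longleftrightarrow>
     anchored_vec n q = anchored_vec n p \<or> anchored_vec n q = - anchored_vec n p"
    (is "?C \<longleftrightarrow> ?S")
proof
  assume ?C
  then have sq: "(p i - p j)\<^sup>2 = (q i - q j)\<^sup>2" if "i \<in> {0..n}" "j \<in> {0..n}" for i j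
    using that by (simp add: congruent_configurations_def graph_of_def c_sq_def)
  have polarize: "2 * ((r i - r 0) * (r j - r 0)) = (r i - r 0)\<^sup>2 + (r j - r 0)\<^sup>2 - (r i - r j)\<^sup>2"
    for r :: "nat \<Rightarrow> complex" and i j
    by (simp add: power2_eq_square algebra_simps)
  have "(p i - p 0) * (p j - p 0) = (q i - q 0) * (q j - q 0)"
    if "i \<in> {0..n}" "j \<in> {0..n}" for i j
  proof -
    have "2 * ((p i - p 0) * (p j - p 0)) = 2 * ((q i - q 0) * (q j - q 0))"
      unfolding polarize using that by (simp add: sq)
    then show ?thesis by simp
  qed
  then show ?S
    unfolding anchored_vec_eq_iff by (rule eq_up_to_sign_of_products_eq)
next
  assume S: ?S
  have "(p i - p j)\<^sup>2 = (q i - q j)\<^sup>2" if "i \<in> {0..n}" "j \<in> {0..n}" for i j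
  proof -
    have "(q i - q j)\<^sup>2 = ((q i - q 0) - (q j - q 0))\<^sup>2" by simp
    also have "\<dots> = (p i - p j)\<^sup>2"
      using S unfolding anchored_vec_eq_iff
    proof
      assume "\<forall>i\<in>{0..n}. q i - q 0 = p i - p 0"
      then have "(q i - q 0) - (q j - q 0) = (p i - p 0) - (p j - p 0)"
        using that by (simp only:)
      then show ?thesis by simp
    next
      assume "\<forall>i\<in>{0..n}. q i - q 0 = - (p i - p 0)"
      then have "(q i - q 0) - (q j - q 0) = - (p i - p 0) - - (p j - p 0)"
        using that by (simp only:)
      then show ?thesis by (simp add: power2_commute)
    qed
    finally show ?thesis ..
  qed
  then show ?C
    by (simp add: congruent_configurations_def graph_of_def c_sq_def)
qed

lemma inj_on_intensity_quot_iff: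
  assumes "set \<Phi> \<subseteq> carrier_vec n"
  shows "inj_on (intensity_quot \<Phi>) (quot_pm n) \<longleftrightarrow>
    (\<forall>x\<in>carrier_vec n. \<forall>y\<in>carrier_vec n. intensity \<Phi> x = intensity \<Phi> y \<longrightarrow> y = x \<or> y = - x)"
proof -
  have class_eq: "pm_rel n `` {x} = pm_rel n `` {y} \<longleftrightarrow> y = x \<or> y = - x"
    if "x \<in> carrier_vec n" "y \<in> carrier_vec n" for x y
    using eq_equiv_class_iff[OF equiv_pm_rel that] that by (simp add: pm_rel_def)
  have quot: "quot_pm n = (\<lambda>x. pm_rel n `` {x}) ` carrier_vec n"
    by (auto simp: quot_pm_def quotient_def)
  show ?thesis
    unfolding quot inj_on_def
    by (simp add: intensity_quot_class[OF assms] class_eq)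
qed

theorem theorem5:
  fixes n :: nat and \<Phi> :: "complex vec list"
  assumes "n \<ge> 1"
    and "set \<Phi> \<subseteq> basis_and_differences n"
  shows "inj_on (intensity_quot \<Phi>) (quot_pm n) \<longleftrightarrow>
    (\<forall>p\<in>configurations (graph_of n \<Phi>). globally_rigid (graph_of n \<Phi>) p)"
proof -
  let ?C = "configurations (graph_of n \<Phi>)"
  have carrier: "carrier_vec n = anchored_vec n ` ?C"
    using anchored_vec_surj[of _ n \<Phi>] by (auto simp: image_iff Bex_def eq_commute)
  have "set \<Phi> \<subseteq> carrier_vec n"
    using assms(2) basis_and_differences_carrier by blast
  then have "inj_on (intensity_quot \<Phi>) (quot_pm n) \<longleftrightarrow>
      (\<forall>x\<in>carrier_vec n. \<forall>y\<in>carrier_vec n. intensity \<Phi> x = intensity \<Phi> y \<longrightarrow> y = x \<or> y = - x)"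
    by (rule inj_on_intensity_quot_iff)
  also have "\<dots> \<longleftrightarrow> (\<forall>p\<in>?C. \<forall>q\<in>?C.
      intensity \<Phi> (anchored_vec n p) = intensity \<Phi> (anchored_vec n q) \<longrightarrow>
      anchored_vec n q = anchored_vec n p \<or> anchored_vec n q = - anchored_vec n p)"
    unfolding carrier by simp
  also have "\<dots> \<longleftrightarrow> (\<forall>p\<in>?C. globally_rigid (graph_of n \<Phi>) p)"
    unfolding globally_rigid_def intensity_eq_iff_equivalent[OF assms(2)]
      congruent_iff_anchored_vec_eq_up_to_sign ..
  finally show ?thesis .
qed

end
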